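(* Let $\mathcal{F}$ be a family of concept classes on $\mathcal{X}$ and let $\mathcal{A}$ be a deterministic online learning algorithm whose access to the unknown concept class is only through the restricted ERM oracle. Suppose that at each timestep $t$, for any function returned by the oracle, $\mathcal{A}$ evaluates that function only on the points $x_1,x_2,\dots,x_t$. If $\mathcal{A}$ makes at most $f(T)$ mistakes and uses at most $g(T)$ oracle queries over $T$ rounds, then there exists an online learning algorithm that uses the weak consistency oracle (instead of the restricted ERM oracle), makes at most $f(T)$ mistakes, and uses at most $T\cdot g(T)$ weak consistency queries over $T$ rounds.
   Context: Online learning with oracle access (realizable setting). Let $\mathcal{X}$ be an instance space and $\mathcal{F}$ a family of (nonempty) concept classes $\mathcal{C}\subseteq\{0,1\}^{\mathcal{X}}$. The learner knows $\mathcal{F}$ and $T$. The adversary fixes an unknown $\mathcal{C}\in\mathcal{F}$, a target $c\in\mathcal{C}$ and a sequence $x_{1:T}\in\mathcal{X}^T$. The learner can access $\mathcal{C}$ only by querying an oracle. In round $t=1,\dots,T$: the learner observes $x_t$, may make oracle queries, predicts $\hat y_t\in\{0,1\}$; then $y_t=c(x_t)$ is revealed, and a mistake occurs if $\hat y_t\neq y_t$. Bounds on mistakes and queries are worst case over $\mathcal{C}\in\mathcal{F}$, $c\in\mathcal{C}$, $x_{1:T}\in\mathcal{X}^T$, and over all valid answers of the oracle. Restricted ERM oracle: at round $t$, it may be queried on any subsequence $S$ of the pairs $(x_1,y_1),\dots,(x_{t-1},y_{t-1})$ generated so far by the adversary; if $S$ is realizable by $\mathcal{C}$ (some concept in $\mathcal{C}$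 agrees with all pairs in $S$) it returns some $c'\in\mathcal{C}$ consistent with $S$, otherwise it returns "not realizable". Weak consistency oracle: given any finite sequence $S=(x_1,y_1),\dots,(x_n,y_n)$ in $\mathcal{X}\times\{0,1\}$, it returns "realizable" if some $c'\in\mathcal{C}$ is consistent with $S$, and "not realizable" otherwise. *)

theory Defs
  imports Complex_Main "HOL-Library.Sublist"
begin

section \<open>Learners that interact with an oracle\<close>

text \<open>
  What a learner does within one round: finitely many requests, each with a Boolean response,
  followed by a prediction. Labels in \<open>{0,1}\<close> are rendered as Booleans. Since this is an
  inductive datatype, every round ends with a prediction.
\<close>

datatype 'q program = Predict bool | Ask 'q "bool \<Rightarrow> 'q program"

text \<open>Everything the learner has seen in a completed round, its own actions included.\<close>

datatype ('x, 'q) round_log =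
  Round (point: 'x) (dialogue: "('q \<times> bool) list") (prediction: bool) (label: bool)

text \<open>
  A deterministic learner knows the horizon \<open>T\<close>, the logs of the previous rounds and the
  current instance. It receives information about the concept class only through the responses.
\<close>

type_synonym ('x, 'q) learner = "nat \<Rightarrow> ('x, 'q) round_log list \<Rightarrow> 'x \<Rightarrow> 'q program"

text \<open>A response may depend on all requests made earlier in the game.\<close>

type_synonym 'q responder = "'q list \<Rightarrow> 'q \<Rightarrow> bool"

primrec execute :: "'q responder \<Rightarrow> 'q list \<Rightarrow> 'q program \<Rightarrow> ('q \<times> bool) list \<times> bool" where
  "execute R qs (Predict b) = ([], b)"
| "execute R qs (Ask q k) =
     (let r = R qs q; (d, b) = execute R (qs @ [q]) (k r) in ((q, r) # d, b))"

definition requests :: "('x, 'q) round_log list \<Rightarrow> 'q list" where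
  "requests logs = concat (map (\<lambda>l. map fst (dialogue l)) logs)"

primrec play :: "'q responder \<Rightarrow> ('x \<Rightarrow> bool) \<Rightarrow>
    (('x, 'q) round_log list \<Rightarrow> 'x \<Rightarrow> 'q program) \<Rightarrow>
    ('x, 'q) round_log list \<Rightarrow> 'x list \<Rightarrow> ('x, 'q) round_log list" where
  "play R c A logs [] = logs"
| "play R c A logs (x # xs) =
     (let (d, b) = execute R (requests logs) (A logs x)
      in play R c A (logs @ [Round x d b (c x)]) xs)"

definition run :: "'q responder \<Rightarrow> ('x \<Rightarrow> bool) \<Rightarrow> ('x, 'q) learner \<Rightarrow> 'x list \<Rightarrow>
    ('x, 'q) round_log list" where
  "run R c A xs = play R c (A (length xs)) [] xs"

definition mistakes :: "('x, 'q) round_log list \<Rightarrow> nat" where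
  "mistakes logs = length (filter (\<lambda>l. prediction l \<noteq> label l) logs)"


section \<open>The two oracles\<close>

definition consistent :: "('x \<Rightarrow> bool) \<Rightarrow> ('x \<times> bool) list \<Rightarrow> bool" where
  "consistent h S \<longleftrightarrow> (\<forall>(x, y) \<in> set S. h x = y)"

definition realizable :: "('x \<Rightarrow> bool) set \<Rightarrow> ('x \<times> bool) list \<Rightarrow> bool" where
  "realizable C S \<longleftrightarrow> (\<exists>h\<in>C. consistent h S)"

definition weak_reply :: "('x \<Rightarrow> bool) set \<Rightarrow> ('x \<times> bool) list responder" where
  "weak_reply C qs S \<longleftrightarrow> realizable C S"

text \<open>
  A learner with ERM access can query the oracle, and it can evaluate the function returned for
  its \<open>j\<close>-th query of the game (counting from 0) at a point. Such evaluations are its only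
  access to the returned functions, may refer to functions obtained in earlier rounds, and are
  not oracle queries.
\<close>

datatype 'x erm_request = Query "('x \<times> bool) list" | Evaluate nat 'x

fun erm_queries :: "'x erm_request list \<Rightarrow> ('x \<times> bool) list list" where
  "erm_queries [] = []"
| "erm_queries (Query S # qs) = S # erm_queries qs"
| "erm_queries (Evaluate j x # qs) = erm_queries qs"

text \<open>
  \<open>orc n S\<close> is the answer to the \<open>n\<close>-th query of the game if that query is \<open>S\<close>, with
  \<open>None\<close> for ``not realizable''. Repeated queries need not get the same answer, and since the
  learner is deterministic, every sequence of valid answers (also by an adaptive oracle) arises
  from some \<open>orc\<close>.
\<close>

type_synonym 'x erm_oracle = "nat \<Rightarrow> ('x \<times> bool) list \<Rightarrow> ('x \<Rightarrow> bool) option"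

definition valid_erm_oracle :: "('x \<Rightarrow> bool) set \<Rightarrow> 'x erm_oracle \<Rightarrow> bool" where
  "valid_erm_oracle C orc \<longleftrightarrow>
     (\<forall>n S. case orc n S of
              Some h \<Rightarrow> h \<in> C \<and> consistent h S
            | None \<Rightarrow> \<not> realizable C S)"

text \<open>
  The response to a query tells whether a function was returned. Evaluating where no function
  was returned yields \<open>False\<close>, which carries no information.
\<close>

fun erm_reply :: "'x erm_oracle \<Rightarrow> 'x erm_request responder" where
  "erm_reply orc qs (Query S) \<longleftrightarrow> orc (length (erm_queries qs)) S \<noteq> None"
| "erm_reply orc qs (Evaluate j x) \<longleftrightarrow>
     j < length (erm_queries qs) \<and>
     (case orc j (erm_queries qs ! j) of None \<Rightarrow> False | Some h \<Rightarrow> h x)"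

definition erm_run :: "'x erm_oracle \<Rightarrow> ('x \<Rightarrow> bool) \<Rightarrow> ('x, 'x erm_request) learner \<Rightarrow>
    'x list \<Rightarrow> ('x, 'x erm_request) round_log list" where
  "erm_run orc = run (erm_reply orc)"

definition weak_run :: "('x \<Rightarrow> bool) set \<Rightarrow> ('x \<Rightarrow> bool) \<Rightarrow>
    ('x, ('x \<times> bool) list) learner \<Rightarrow> 'x list \<Rightarrow> ('x, ('x \<times> bool) list) round_log list" where
  "weak_run C = run (weak_reply C)"

definition num_erm_queries :: "('x, 'x erm_request) round_log list \<Rightarrow> nat" where
  "num_erm_queries logs = length (erm_queries (requests logs))"

definition num_weak_queries :: "('x, ('x \<times> bool) list) round_log list \<Rightarrow> nat" where
  "num_weak_queries logs = length (requests logs)"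


section \<open>Restrictions on learners with ERM access\<close>

text \<open>
  Rounds are indexed from 0, so the rounds before round \<open>t\<close> have the instances \<open>take t xs\<close>.
\<close>

definition uses_restricted_erm ::
    "('x \<Rightarrow> bool) set set \<Rightarrow> ('x, 'x erm_request) learner \<Rightarrow> bool" where
  "uses_restricted_erm F A \<longleftrightarrow>
     (\<forall>C\<in>F. \<forall>c\<in>C. \<forall>xs orc. valid_erm_oracle C orc \<longrightarrow>
       (\<forall>t < length xs. \<forall>S.
          Query S \<in> fst ` set (dialogue (erm_run orc c A xs ! t)) \<longrightarrow>
          subseq S (map (\<lambda>x. (x, c x)) (take t xs))))"

definition evaluates_only_on_observed ::
    "('x \<Rightarrow> bool) set set \<Rightarrow> ('x, 'x erm_request) learner \<Rightarrow> bool" where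
  "evaluates_only_on_observed F A \<longleftrightarrow>
     (\<forall>C\<in>F. \<forall>c\<in>C. \<forall>xs orc. valid_erm_oracle C orc \<longrightarrow>
       (\<forall>t < length xs. \<forall>j x.
          Evaluate j x \<in> fst ` set (dialogue (erm_run orc c A xs ! t)) \<longrightarrow>
          x \<in> set (take (Suc t) xs)))"

end

theory Submission
  imports Defs
begin

text \<open>
  A restricted ERM query consists of pairs labelled by the target, hence is always realizable, and
  the values of the returned function matter only on the observed points. Starting from the sample
  \<open>S\<close> of a query, label the points \<open>x\<^sub>1, x\<^sub>2, \<dots>\<close> greedily: \<open>x\<^sub>i\<close> gets \<open>True\<close> iff \<open>S\<close> with the labels
  chosen so far remains realizable when \<open>(x\<^sub>i, True)\<close> is added. The labelled sample stays realizable,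
  so some concept carries these labels and may be assumed to be the answer of the ERM oracle. Each
  label costs one weak query, which gives \<open>T\<close> weak queries per ERM query.

  The new learner simulates the given one from the first round in every round, but asks only those
  weak queries whose answers do not occur in the logs. Its requests are therefore distinct, and it
  suffices to bound the number of weak queries that can possibly arise.
\<close>

section \<open>Memoryless responders\<close>

primrec decision :: "('q \<Rightarrow> bool) \<Rightarrow> 'q program \<Rightarrow> bool" where
  "decision \<rho> (Predict b) = b"
| "decision \<rho> (Ask q k) = decision \<rho> (k (\<rho> q))"

primrec asked :: "('q \<Rightarrow> bool) \<Rightarrow> 'q program \<Rightarrow> 'q list" where
  "asked \<rho> (Predict b) = []"
| "asked \<rho> (Ask q k) = q # asked \<rho> (k (\<rho> q))"

lemma execute_memoryless:
  "execute (\<lambda>_. \<rho>) qs p = (map (\<lambda>q. (q, \<rho> q)) (asked \<rho> p), decision \<rho> p)"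
  by (induction p arbitrary: qs) (auto simp: Let_def)

primrec memo :: "('q \<times> bool) list \<Rightarrow> 'q program \<Rightarrow> 'q program" where
  "memo K (Predict b) = Predict b"
| "memo K (Ask q k) =
     (case map_of K q of
        Some r \<Rightarrow> memo K (k r)
      | None \<Rightarrow> Ask q (\<lambda>r. memo ((q, r) # K) (k r)))"

text \<open>Skipping is sound because \<open>\<rho>\<close> ignores history: a stored answer is the
  one that would be given again. Subtracting the keys of \<open>K\<close> keeps a round's requests
  disjoint from those of earlier rounds; distinctness within the round comes from extending
  \<open>K\<close> after each answer.\<close>

lemma memo_correct:
  assumes "\<forall>(q, r) \<in> set K. r = \<rho> q"
  shows "decision \<rho> (memo K p) = decision \<rho> p \<and> distinct (asked \<rho> (memo K p)) \<and>
    set (asked \<rho> (memo K p)) \<subseteq> set (asked \<rho> p) - fst ` set K"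
  using assms
proof (induction p arbitrary: K)
  case (Predict b)
  show ?case by simp
next
  case (Ask q k)
  note IH = Ask.IH[OF rangeI]
  show ?case
  proof (cases "map_of K q")
    case None
    then have "q \<notin> fst ` set K" by (simp add: map_of_eq_None_iff)
    with None IH[of "(q, \<rho> q) # K"] Ask.prems show ?thesis by auto
  next
    case (Some r)
    then have "r = \<rho> q" using Ask.prems map_of_SomeD by fastforce
    with Some IH[of K] Ask.prems show ?thesis by auto
  qed
qed

section \<open>Runs\<close>

lemma requests_simps [simp]:
  "requests [] = []"
  "requests (logs @ [Round x d b y]) = requests logs @ map fst d"
  by (simp_all add: requests_def)

lemma play_append: "play R c A logs (xs @ ys) = play R c A (play R c A logs xs) ys"
  by (induction xs arbitrary: logs) (auto split: prod.split)

lemma play_observed: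
  "map point (play R c A logs xs) = map point logs @ xs"
  "map label (play R c A logs xs) = map label logs @ map c xs"
  by (induction xs arbitrary: logs) (auto split: prod.split)

lemma prefix_play: "prefix logs (play R c A logs xs)"
proof (induction xs arbitrary: logs)
  case (Cons x xs)
  then show ?case by (auto split: prod.split intro: append_prefixD)
qed simp

lemma requests_prefix: "prefix ls ls' \<Longrightarrow> prefix (requests ls) (requests ls')"
  by (auto simp: prefix_def requests_def)

text \<open>The learner is online and logs only grow, so later instances cannot change earlier
  rounds. The horizon is already fixed inside \<open>A\<close>, so it stays the same for the shorter
  sequence.\<close>

lemma play_take:
  assumes "t \<le> length xs"
  shows "play R c A [] (take t xs) = take t (play R c A [] xs)"
proof -
  have len: "length (play R c A [] (take t xs)) = t"
    using arg_cong[OF play_observed(1), of length R c A "[]" "take t xs"] assms by simp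
  have "prefix (play R c A [] (take t xs)) (play R c A [] xs)"
    using prefix_play play_append by (metis append_take_drop_id)
  then show ?thesis using len by (auto simp: prefix_def)
qed

lemma erm_queries_append: "erm_queries (qs @ rs) = erm_queries qs @ erm_queries rs"
  by (induction qs rule: erm_queries.induct) auto

lemma set_erm_queries: "S \<in> set (erm_queries qs) \<longleftrightarrow> Query S \<in> set qs"
  by (induction qs rule: erm_queries.induct) auto

section \<open>Greedy labelling\<close>

primrec greedy :: "(('x \<times> bool) list \<Rightarrow> bool) \<Rightarrow> ('x \<times> bool) list \<Rightarrow> 'x list \<Rightarrow> ('x \<times> bool) list" where
  "greedy \<rho> S [] = S"
| "greedy \<rho> S (x # xs) = greedy \<rho> ((x, \<rho> ((x, True) # S)) # S) xs"

text \<open>The label given to the first occurrence of \<open>x\<close>. Cutting the list there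
  makes the value independent of all later points.\<close>

definition greedy_value :: "(('x \<times> bool) list \<Rightarrow> bool) \<Rightarrow> ('x \<times> bool) list \<Rightarrow> 'x list \<Rightarrow> 'x \<Rightarrow> bool" where
  "greedy_value \<rho> S xs x = \<rho> ((x, True) # greedy \<rho> S (takeWhile (\<lambda>y. y \<noteq> x) xs))"

text \<open>Depends on the sample and the points only, not on the round of an evaluation or the
  point evaluated; hence all evaluations of one returned function share at most
  \<open>length xs\<close> weak queries.\<close>

definition greedy_queries ::
    "(('x \<times> bool) list \<Rightarrow> bool) \<Rightarrow> 'x list \<Rightarrow> ('x \<times> bool) list \<Rightarrow> ('x \<times> bool) list set" where
  "greedy_queries \<rho> xs S = (\<lambda>i. (xs ! i, True) # greedy \<rho> S (take i xs)) ` {..<length xs}"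

lemma greedy_append: "greedy \<rho> S (xs @ ys) = greedy \<rho> (greedy \<rho> S xs) ys"
  by (induction xs arbitrary: S) auto

lemma greedy_superset: "set S \<subseteq> set (greedy \<rho> S xs)"
proof (induction xs arbitrary: S)
  case (Cons x xs)
  from Cons.IH[of "(x, \<rho> ((x, True) # S)) # S"] show ?case by simp
qed simp

text \<open>If \<open>(x, True)\<close> cannot be added, every witness for \<open>S\<close> takes
  the value \<open>False\<close> at \<open>x\<close> and so also realizes the extended
  sample.\<close>

lemma realizable_greedy:
  "realizable C S \<Longrightarrow> realizable C (greedy (realizable C) S xs)"
proof (induction xs arbitrary: S)
  case (Cons x xs)
  have "realizable C ((x, realizable C ((x, True) # S)) # S)"
  proof (cases "realizable C ((x, True) # S)")
    case False
    obtain h where "h \<in> C" "consistent h S"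
      using Cons.prems by (auto simp: realizable_def)
    with False have "h \<in> C" "consistent h ((x, False) # S)"
      by (auto simp: realizable_def consistent_def)
    with False show ?thesis by (auto simp: realizable_def)
  qed simp
  then show ?case using Cons.IH by simp
qed simp

lemma first_occurrence: "x \<in> set xs \<Longrightarrow> \<exists>zs. takeWhile (\<lambda>y. y \<noteq> x) xs @ x # zs = xs"
  by (induction xs) auto

lemma greedy_value_mem:
  assumes "x \<in> set xs"
  shows "(x, greedy_value \<rho> S xs x) \<in> set (greedy \<rho> S xs)"
proof -
  let ?ys = "takeWhile (\<lambda>y. y \<noteq> x) xs"
  obtain zs where zs: "?ys @ x # zs = xs" using first_occurrence[OF assms] by blast
  have "greedy \<rho> S (?ys @ x # zs) = greedy \<rho> ((x, greedy_value \<rho> S xs x) # greedy \<rho> S ?ys) zs"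
    by (simp add: greedy_append greedy_value_def)
  then have "(x, greedy_value \<rho> S xs x) \<in> set (greedy \<rho> S (?ys @ x # zs))"
    using greedy_superset by fastforce
  then show ?thesis unfolding zs .
qed

lemma takeWhile_prefix:
  assumes "prefix ps xs" "x \<in> set ps"
  shows "takeWhile (\<lambda>y. y \<noteq> x) ps = takeWhile (\<lambda>y. y \<noteq> x) xs"
  using assms by (auto simp: prefix_def)

text \<open>Labels the whole sequence, future points included. The learner cannot compute this
  function, but it exists only in the analysis, and it makes one fixed oracle serve all
  rounds.\<close>

definition greedy_oracle :: "('x \<Rightarrow> bool) set \<Rightarrow> 'x list \<Rightarrow> 'x erm_oracle" where
  "greedy_oracle C xs n S =
     (if realizable C S
      then Some (SOME h. h \<in> C \<and> consistent h (greedy (realizable C) S xs)) else None)"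

lemma greedy_oracle_Some:
  assumes "realizable C S"
  obtains h where "greedy_oracle C xs n S = Some h" "h \<in> C"
    "consistent h (greedy (realizable C) S xs)"
proof -
  have "\<exists>h. h \<in> C \<and> consistent h (greedy (realizable C) S xs)"
    using realizable_greedy[OF assms] unfolding realizable_def by blast
  from someI_ex[OF this] that assms show ?thesis by (simp add: greedy_oracle_def)
qed

lemma valid_greedy_oracle: "valid_erm_oracle C (greedy_oracle C xs)"
  unfolding valid_erm_oracle_def
proof (intro allI)
  fix n S
  show "case greedy_oracle C xs n S of None \<Rightarrow> \<not> realizable C S
      | Some h \<Rightarrow> h \<in> C \<and> consistent h S"
  proof (cases "realizable C S")
    case True
    then obtain h where "greedy_oracle C xs n S = Some h" "h \<in> C"
      "consistent h (greedy (realizable C) S xs)" by (rule greedy_oracle_Some)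
    then show ?thesis using greedy_superset by (fastforce simp: consistent_def)
  qed (simp add: greedy_oracle_def)
qed

text \<open>The prefix \<open>ps\<close> contains the first occurrence of \<open>x\<close> in
  \<open>xs\<close>, so the value at an observed point can be found without the future
  points.\<close>

lemma greedy_oracle_value:
  assumes "realizable C S" "prefix ps xs" "x \<in> set ps"
  shows "(case greedy_oracle C xs n S of None \<Rightarrow> False | Some h \<Rightarrow> h x) =
    greedy_value (realizable C) S ps x"
proof -
  obtain h where h: "greedy_oracle C xs n S = Some h"
    "consistent h (greedy (realizable C) S xs)"
    using assms(1) by (rule greedy_oracle_Some)
  have "x \<in> set xs" using assms set_mono_prefix by blast
  then have "h x = greedy_value (realizable C) S xs x"
    using h(2) greedy_value_mem by (fastforce simp: consistent_def)
  then show ?thesis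
    using h(1) takeWhile_prefix[OF assms(2,3)] by (simp add: greedy_value_def)
qed

section \<open>Simulation\<close>

primrec label_greedily :: "('x \<times> bool) list \<Rightarrow> 'x list \<Rightarrow> 'x \<Rightarrow>
    (bool \<Rightarrow> ('x \<times> bool) list program) \<Rightarrow> ('x \<times> bool) list program" where
  "label_greedily S [] x k = Ask ((x, True) # S) k"
| "label_greedily S (y # ys) x k =
     Ask ((y, True) # S) (\<lambda>r. label_greedily ((y, r) # S) ys x k)"

text \<open>A restricted query is realizable, so \<open>True\<close> is returned at no cost. Weak
  queries are spent only on evaluations; an index with no query behind it gets the default
  \<open>False\<close> of \<open>erm_reply\<close>.\<close>

fun respond :: "'x list \<Rightarrow> 'x erm_request list \<Rightarrow> 'x erm_request \<Rightarrow>
    (bool \<Rightarrow> ('x \<times> bool) list program) \<Rightarrow> ('x \<times> bool) list program" where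
  "respond ps qs (Query S) k = k True"
| "respond ps qs (Evaluate j x) k =
     (if j < length (erm_queries qs)
      then label_greedily (erm_queries qs ! j) (takeWhile (\<lambda>y. y \<noteq> x) ps) x k
      else k False)"

text \<open>Continuation-passing style lets consecutive simulated rounds be chained into a single
  program; \<open>d\<close> collects the dialogue that the simulated log must contain.\<close>

primrec simulate_round :: "'x list \<Rightarrow>
    (('x erm_request \<times> bool) list \<Rightarrow> bool \<Rightarrow> ('x \<times> bool) list program) \<Rightarrow>
    'x erm_request list \<Rightarrow> ('x erm_request \<times> bool) list \<Rightarrow> 'x erm_request program \<Rightarrow>
    ('x \<times> bool) list program" where
  "simulate_round ps k qs d (Predict b) = k d b"
| "simulate_round ps k qs d (Ask q p) =
     respond ps qs q (\<lambda>v. simulate_round ps k (qs @ [q]) (d @ [(q, v)]) (p v))"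

primrec simulate_game :: "'x list \<Rightarrow>
    (('x, 'x erm_request) round_log list \<Rightarrow> 'x \<Rightarrow> 'x erm_request program) \<Rightarrow>
    ('x, 'x erm_request) round_log list \<Rightarrow> ('x \<times> bool) list \<Rightarrow> 'x \<Rightarrow>
    ('x \<times> bool) list program" where
  "simulate_game ps A logs [] x =
     simulate_round ps (\<lambda>d b. Predict b) (requests logs) [] (A logs x)"
| "simulate_game ps A logs (z # zs) x =
     simulate_round ps (\<lambda>d b. simulate_game ps A (logs @ [Round (fst z) d b (snd z)]) zs x)
       (requests logs) [] (A logs (fst z))"

definition weak_learner :: "('x, 'x erm_request) learner \<Rightarrow> ('x, ('x \<times> bool) list) learner" where
  "weak_learner A T logs x =
     memo (concat (map dialogue logs))
       (simulate_game (map point logs @ [x]) (A T) [] (map (\<lambda>l. (point l, label l)) logs) x)"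

text \<open>What \<open>respond\<close> needs in order to agree with \<open>greedy_oracle\<close>;
  it does not mention the target.\<close>

fun harmless :: "('x \<Rightarrow> bool) set \<Rightarrow> 'x list \<Rightarrow> 'x erm_request \<Rightarrow> bool" where
  "harmless C ps (Query S) \<longleftrightarrow> realizable C S"
| "harmless C ps (Evaluate j x) \<longleftrightarrow> x \<in> set ps"

section \<open>Correctness of the simulation: one request, one round, one game, all rounds\<close>

lemma decision_label_greedily:
  "decision \<rho> (label_greedily S ys x k) = decision \<rho> (k (\<rho> ((x, True) # greedy \<rho> S ys)))"
  by (induction ys arbitrary: S) auto

lemma asked_label_greedily:
  "set (asked \<rho> (label_greedily S ys x k)) =
     greedy_queries \<rho> (ys @ [x]) S \<union> set (asked \<rho> (k (\<rho> ((x, True) # greedy \<rho> S ys))))"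
proof (induction ys arbitrary: S)
  case (Cons y ys)
  then show ?case
    by (simp add: greedy_queries_def lessThan_Suc_eq_insert_0 image_image)
qed (simp add: greedy_queries_def lessThan_Suc)

lemma greedy_queries_prefix:
  assumes "prefix ps xs"
  shows "greedy_queries \<rho> ps S \<subseteq> greedy_queries \<rho> xs S"
  using assms by (fastforce simp: greedy_queries_def prefix_def nth_append)

lemma respond_correct:
  fixes C :: "('x \<Rightarrow> bool) set"
  defines "\<rho> \<equiv> realizable C"
  assumes "prefix ps xs" "harmless C ps q" "\<forall>S \<in> set (erm_queries qs). realizable C S"
  defines "v \<equiv> erm_reply (greedy_oracle C xs) qs q"
  shows "decision \<rho> (respond ps qs q k) = decision \<rho> (k v) \<and>
    set (asked \<rho> (respond ps qs q k)) \<subseteq>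
      (\<Union>S \<in> set (erm_queries qs). greedy_queries \<rho> xs S) \<union> set (asked \<rho> (k v))"
proof (cases q)
  case (Query S)
  with assms(3) have v unfolding v_def by (simp add: greedy_oracle_def)
  then show ?thesis using Query by simp
next
  case (Evaluate j x)
  show ?thesis
  proof (cases "j < length (erm_queries qs)")
    case True
    let ?S = "erm_queries qs ! j" and ?ys = "takeWhile (\<lambda>y. y \<noteq> x) ps"
    have x: "x \<in> set ps" using assms(3) Evaluate by simp
    have S: "?S \<in> set (erm_queries qs)" using True by simp
    have v: "v = \<rho> ((x, True) # greedy \<rho> ?S ?ys)"
      using greedy_oracle_value[OF _ assms(2) x, of C ?S j] assms(4) S True Evaluate
      unfolding v_def \<rho>_def greedy_value_def by simp
    obtain zs where "(?ys @ [x]) @ zs = ps" using first_occurrence[OF x] by auto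
    then have "prefix (?ys @ [x]) ps" by (rule prefixI[OF sym])
    \<comment> \<open>Labelling up to \<open>x\<close> asks an initial segment of the queries that
      label all of \<open>xs\<close>.\<close>
    then have "greedy_queries \<rho> (?ys @ [x]) ?S \<subseteq> greedy_queries \<rho> xs ?S"
      using assms(2) greedy_queries_prefix prefix_order.order_trans by metis
    from order_trans[OF this UN_upper[OF S, of "greedy_queries \<rho> xs"]] show ?thesis
      using True Evaluate by (simp add: decision_label_greedily asked_label_greedily v le_supI1)
  next
    case False
    then have "\<not> v" using Evaluate unfolding v_def by simp
    with False show ?thesis using Evaluate by simp
  qed
qed

lemma simulate_round_correct:
  fixes C :: "('x \<Rightarrow> bool) set"
  defines "\<rho> \<equiv> realizable C"
  assumes "prefix ps xs"
    and "execute (erm_reply (greedy_oracle C xs)) qs p = (d', b)"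
    and "\<forall>q \<in> set (qs @ map fst d'). harmless C ps q"
  shows "decision \<rho> (simulate_round ps k qs d p) = decision \<rho> (k (d @ d') b) \<and>
    set (asked \<rho> (simulate_round ps k qs d p)) \<subseteq>
      (\<Union>S \<in> set (erm_queries (qs @ map fst d')). greedy_queries \<rho> xs S) \<union>
      set (asked \<rho> (k (d @ d') b))"
  using assms(3,4)
proof (induction p arbitrary: qs d d')
  case (Predict b)
  then show ?case by simp
next
  case (Ask q p)
  define v where "v = erm_reply (greedy_oracle C xs) qs q"
  obtain e where e: "execute (erm_reply (greedy_oracle C xs)) (qs @ [q]) (p v) = (e, b)"
    and d': "d' = (q, v) # e"
    using Ask.prems(1) by (auto simp: v_def Let_def split: prod.splits)
  have q: "harmless C ps q" using Ask.prems(2) d' by simp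
  have qs: "\<forall>S \<in> set (erm_queries qs). realizable C S"
    using Ask.prems(2) harmless.simps(1) set_erm_queries by (metis UnI1 set_append)
  have h: "\<forall>q \<in> set ((qs @ [q]) @ map fst e). harmless C ps q"
    using Ask.prems(2) d' by auto
  have eq: "(qs @ [q]) @ map fst e = qs @ map fst d'" "(d @ [(q, v)]) @ e = d @ d'"
    by (simp_all add: d')
  note IH = Ask.IH[OF rangeI e h, of "d @ [(q, v)]", unfolded eq]
  note R = respond_correct[OF assms(2) q qs, of
      "\<lambda>v. simulate_round ps k (qs @ [q]) (d @ [(q, v)]) (p v)", folded v_def \<rho>_def]
  have "(\<Union>S \<in> set (erm_queries qs). greedy_queries \<rho> xs S) \<subseteq>
      (\<Union>S \<in> set (erm_queries (qs @ map fst d')). greedy_queries \<rho> xs S)"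
    by (auto simp: erm_queries_append)
  then show ?case using IH R unfolding simulate_round.simps by blast
qed

text \<open>Replayed rounds use the current points \<open>ps\<close>, not those seen at the time;
  the greedy values are the same for every prefix containing the evaluated point, so the replay
  reproduces the original dialogue.\<close>

lemma simulate_game_correct:
  fixes C :: "('x \<Rightarrow> bool) set" and c
  defines "\<rho> \<equiv> realizable C"
  assumes "prefix ps xs"
    and "play (erm_reply (greedy_oracle C xs)) c A logs (ys @ [x]) = logs'"
    and "\<forall>q \<in> set (requests logs'). harmless C ps q"
  shows "decision \<rho> (simulate_game ps A logs (map (\<lambda>y. (y, c y)) ys) x) = prediction (last logs') \<and>
    set (asked \<rho> (simulate_game ps A logs (map (\<lambda>y. (y, c y)) ys) x)) \<subseteq>
      (\<Union>S \<in> set (erm_queries (requests logs')). greedy_queries \<rho> xs S)"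
  using assms(3)
proof (induction ys arbitrary: logs)
  case Nil
  obtain d b where e: "execute (erm_reply (greedy_oracle C xs)) (requests logs) (A logs x) = (d, b)"
    by fastforce
  with Nil have l: "logs' = logs @ [Round x d b (c x)]" by auto
  with assms(4) have "\<forall>q \<in> set (requests logs @ map fst d). harmless C ps q" by simp
  from simulate_round_correct[OF assms(2) e this, of "\<lambda>d b. Predict b" "[]"]
  show ?case using l by (simp add: \<rho>_def)
next
  case (Cons y ys)
  obtain d b where e: "execute (erm_reply (greedy_oracle C xs)) (requests logs) (A logs y) = (d, b)"
    by fastforce
  let ?logs = "logs @ [Round y d b (c y)]"
  have l: "play (erm_reply (greedy_oracle C xs)) c A ?logs (ys @ [x]) = logs'"
    using Cons.prems e by simp
  \<comment> \<open>Requests of the first replayed round are among those of the whole game, so the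
    harmlessness of the latter covers them.\<close>
  obtain rs where rs: "requests logs' = (requests logs @ map fst d) @ rs"
    using requests_prefix[OF prefix_play[of ?logs]] l by (metis prefix_def requests_simps(2))
  with assms(4) have h: "\<forall>q \<in> set (requests logs @ map fst d). harmless C ps q" by auto
  have "(\<Union>S \<in> set (erm_queries (requests logs @ map fst d)). greedy_queries \<rho> xs S) \<subseteq>
      (\<Union>S \<in> set (erm_queries (requests logs')). greedy_queries \<rho> xs S)"
    unfolding rs by (auto simp: erm_queries_append)
  with Cons.IH[OF l] simulate_round_correct[OF assms(2) e h, of
      "\<lambda>d b. simulate_game ps A (logs @ [Round y d b (c y)]) (map (\<lambda>y. (y, c y)) ys) x" "[]"]
  show ?case unfolding \<rho>_def by simp blast
qed

text \<open>The four claims are proved together: correctness of the logged answers is what lets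
  \<open>memo\<close> reuse them in the next round. The oracle is built from the full
  \<open>xs\<close> for every prefix, so the runs \<open>E ys\<close> extend one another.\<close>

lemma weak_learner_correct:
  fixes C :: "('x \<Rightarrow> bool) set" and A :: "('x, 'x erm_request) learner" and xs :: "'x list"
    and c :: "'x \<Rightarrow> bool" and T :: nat
  defines "E \<equiv> \<lambda>ys. play (erm_reply (greedy_oracle C xs)) c (A T) [] ys"
    and "W \<equiv> \<lambda>ys. play (weak_reply C) c (weak_learner A T) [] ys"
  assumes harmless: "\<And>ys q. prefix ys xs \<Longrightarrow> q \<in> set (requests (E ys)) \<Longrightarrow> harmless C ys q"
    and "prefix ys xs"
  shows "map prediction (W ys) = map prediction (E ys) \<and>
    distinct (requests (W ys)) \<and>
    (\<forall>(q, r) \<in> set (concat (map dialogue (W ys))). r = realizable C q) \<and>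
    set (requests (W ys)) \<subseteq>
      (\<Union>S \<in> set (erm_queries (requests (E ys))). greedy_queries (realizable C) xs S)"
  using assms(4)
proof (induction ys rule: rev_induct)
  case Nil
  show ?case by (simp add: W_def E_def)
next
  case (snoc x ys)
  let ?\<rho> = "realizable C"
  let ?K = "concat (map dialogue (W ys))"
  \<comment> \<open>The current point is included, since the simulated learner may evaluate on it
    before predicting.\<close>
  let ?p = "simulate_game (ys @ [x]) (A T) [] (map (\<lambda>y. (y, c y)) ys) x"
  have ys: "prefix ys xs" using snoc.prems append_prefixD by blast
  note IH = snoc.IH[OF ys]
  have K: "\<forall>(q, r) \<in> set ?K. r = ?\<rho> q" using IH by blast
  have requests_K: "set (requests (W ys)) = fst ` set ?K"
    by (simp add: requests_def image_UN map_concat comp_def)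
  have points: "map point (W ys) = ys" and labels: "map label (W ys) = map c ys"
    by (simp_all add: W_def play_observed)
  have "map (\<lambda>l. (point l, label l)) (W ys) = zip (map point (W ys)) (map label (W ys))"
    by (simp add: zip_map_map zip_same_conv_map)
  also have "\<dots> = map (\<lambda>y. (y, c y)) ys"
    unfolding points labels by (simp add: zip_map2 zip_same_conv_map)
  finally have B: "weak_learner A T (W ys) x = memo ?K ?p"
    by (simp add: weak_learner_def points)
  have reply: "weak_reply C = (\<lambda>_. ?\<rho>)" by (intro ext) (simp add: weak_reply_def)
  have W: "W (ys @ [x]) = W ys @ [Round x (map (\<lambda>q. (q, ?\<rho> q)) (asked ?\<rho> (memo ?K ?p)))
      (decision ?\<rho> (memo ?K ?p)) (c x)]"
    unfolding W_def play_append
    by (simp add: B[unfolded W_def reply] reply execute_memoryless)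
  obtain d b where "execute (erm_reply (greedy_oracle C xs)) (requests (E ys)) (A T (E ys) x) = (d, b)"
    by fastforce
  then have E: "E (ys @ [x]) = E ys @ [Round x d b (c x)]"
    by (simp add: E_def play_append)
  have sim: "decision ?\<rho> ?p = prediction (last (E (ys @ [x])))"
    "set (asked ?\<rho> ?p) \<subseteq> (\<Union>S \<in> set (erm_queries (requests (E (ys @ [x])))). greedy_queries ?\<rho> xs S)"
    using simulate_game_correct[OF snoc.prems, of C c "A T" "[]" ys x, folded E_def, OF refl]
      harmless[OF snoc.prems] by blast+
  note M = memo_correct[of ?K ?\<rho> ?p, OF K]
  let ?U = "\<lambda>ys. \<Union>S \<in> set (erm_queries (requests (E ys))). greedy_queries ?\<rho> xs S"
  let ?new = "asked ?\<rho> (memo ?K ?p)"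
  have new: "distinct ?new" "set (requests (W ys)) \<inter> set ?new = {}" "set ?new \<subseteq> ?U (ys @ [x])"
    using M sim(2) unfolding requests_K by blast+
  have "?U ys \<subseteq> ?U (ys @ [x])" unfolding E by (auto simp: erm_queries_append)
  then have "set (requests (W (ys @ [x]))) \<subseteq> ?U (ys @ [x])"
    using IH new(3) unfolding W by (simp add: comp_def) blast
  moreover have "distinct (requests (W (ys @ [x])))"
    using IH new unfolding W by (simp add: comp_def)
  moreover have "map prediction (W (ys @ [x])) = map prediction (E (ys @ [x]))"
    using IH M sim(1) unfolding W E by simp
  moreover have "\<forall>(q, r) \<in> set (concat (map dialogue (W (ys @ [x])))). r = ?\<rho> q"
    using K unfolding W by auto
  ultimately show ?case by blast
qed

section \<open>Counting weak queries and transferring the bounds\<close>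

lemma card_greedy_queries:
  "finite (greedy_queries \<rho> xs S)" "card (greedy_queries \<rho> xs S) \<le> length xs"
  unfolding greedy_queries_def using card_image_le[of "{..<length xs}"] by auto

text \<open>A subsequence of the pairs labelled by \<open>c\<close> is realized by \<open>c\<close>
  itself. For evaluations, a round \<open>t < length ys\<close> has its points up to index
  \<open>t\<close> inside \<open>ys\<close>.\<close>

lemma erm_run_harmless:
  assumes "uses_restricted_erm F A" "evaluates_only_on_observed F A"
    and "C \<in> F" "c \<in> C" "valid_erm_oracle C orc" "prefix ys xs"
    and "q \<in> set (requests (play (erm_reply orc) c (A (length xs)) [] ys))"
  shows "harmless C ys q"
proof -
  let ?E = "erm_run orc c A xs"
  have ys: "take (length ys) xs = ys" "length ys \<le> length xs"
    using assms(6) by (auto simp: prefix_def)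
  have "play (erm_reply orc) c (A (length xs)) [] ys = take (length ys) ?E"
    using play_take[OF ys(2)] by (simp add: ys(1) erm_run_def run_def)
  then obtain l where l: "l \<in> set (take (length ys) ?E)" "q \<in> fst ` set (dialogue l)"
    using assms(7) by (auto simp: requests_def)
  then obtain t where t: "t < length ys" "l = ?E ! t"
    by (auto simp: in_set_conv_nth)
  have q: "q \<in> fst ` set (dialogue (?E ! t))" and tx: "t < length xs" using l t ys(2) by auto
  show ?thesis
  proof (cases q)
    case (Query S)
    then have "subseq S (map (\<lambda>x. (x, c x)) (take t xs))"
      using assms(1)[unfolded uses_restricted_erm_def, rule_format, OF assms(3-5) tx] q by simp
    then have "set S \<subseteq> set (map (\<lambda>x. (x, c x)) (take t xs))"
      by (auto elim: list_emb_set)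
    then have "consistent c S" by (auto simp: consistent_def)
    then show ?thesis using Query assms(4) by (auto simp: realizable_def)
  next
    case (Evaluate j x)
    then have "x \<in> set (take (Suc t) xs)"
      using assms(2)[unfolded evaluates_only_on_observed_def, rule_format, OF assms(3-5) tx] q
      by simp
    moreover have "set (take (Suc t) xs) \<subseteq> set ys"
      using set_take_subset_set_take[of "Suc t" "length ys" xs] t(1) ys(1) by simp
    ultimately show ?thesis using Evaluate by auto
  qed
qed

text \<open>The two runs have logs of different types; this form compares them through predictions
  and labels alone.\<close>

lemma mistakes_conv:
  "mistakes logs = length (filter (\<lambda>(a, b). a \<noteq> b) (zip (map prediction logs) (map label logs)))"
  by (simp add: mistakes_def zip_map_map zip_same_conv_map filter_map comp_def)

theorem theorem3p3:
  fixes F :: "('x \<Rightarrow> bool) set set"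
    and A :: "('x, 'x erm_request) learner"
    and f g :: "nat \<Rightarrow> real"
  assumes nonempty: "\<forall>C\<in>F. C \<noteq> {}"
    and restricted: "uses_restricted_erm F A"
    and observed: "evaluates_only_on_observed F A"
    and mistake_bound: "\<forall>T. \<forall>C\<in>F. \<forall>c\<in>C. \<forall>xs orc.
          length xs = T \<longrightarrow> valid_erm_oracle C orc \<longrightarrow>
          real (mistakes (erm_run orc c A xs)) \<le> f T"
    and query_bound: "\<forall>T. \<forall>C\<in>F. \<forall>c\<in>C. \<forall>xs orc.
          length xs = T \<longrightarrow> valid_erm_oracle C orc \<longrightarrow>
          real (num_erm_queries (erm_run orc c A xs)) \<le> g T"
  shows "\<exists>B :: ('x, ('x \<times> bool) list) learner.
           \<forall>T. \<forall>C\<in>F. \<forall>c\<in>C. \<forall>xs. length xs = T \<longrightarrow>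
             real (mistakes (weak_run C c B xs)) \<le> f T \<and>
             real (num_weak_queries (weak_run C c B xs)) \<le> real T * g T"
proof (intro exI[of _ "weak_learner A"] allI ballI impI)
  fix T C c and xs :: "'x list"
  assume C: "C \<in> F" "c \<in> C" and T: "length xs = T"
  let ?orc = "greedy_oracle C xs" and ?\<rho> = "realizable C"
  let ?E = "erm_run ?orc c A xs" and ?W = "weak_run C c (weak_learner A) xs"
  let ?Q = "erm_queries (requests ?E)"
  have valid: "valid_erm_oracle C ?orc" by (rule valid_greedy_oracle)
  have "map prediction ?W = map prediction ?E" and dist: "distinct (requests ?W)"
    and sub: "set (requests ?W) \<subseteq> (\<Union>S \<in> set ?Q. greedy_queries ?\<rho> xs S)"
    using weak_learner_correct[where ys = xs and xs = xs and T = "length xs",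
        OF erm_run_harmless[OF restricted observed C valid]]
    unfolding weak_run_def erm_run_def run_def by auto
  moreover have "map label ?W = map label ?E"
    by (simp add: weak_run_def erm_run_def run_def play_observed)
  ultimately have "mistakes ?W = mistakes ?E" by (simp add: mistakes_conv)
  then have "real (mistakes ?W) \<le> f T" using mistake_bound C T valid by simp
  moreover have "num_weak_queries ?W \<le> T * num_erm_queries ?E"
  proof -
    \<comment> \<open>Distinctness turns the number of requests into a cardinality, so it is enough
      to bound the set of possible weak queries.\<close>
    have "num_weak_queries ?W = card (set (requests ?W))"
      using dist by (simp add: num_weak_queries_def distinct_card)
    also have "\<dots> \<le> card (\<Union>S \<in> set ?Q. greedy_queries ?\<rho> xs S)"
      using sub by (intro card_mono) (auto simp: card_greedy_queries)
    also have "\<dots> \<le> (\<Sum>S \<in> set ?Q. card (greedy_queries ?\<rho> xs S))"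
      by (intro card_UN_le) simp
    also have "\<dots> \<le> card (set ?Q) * T"
      using sum_bounded_above[of "set ?Q" "\<lambda>S. card (greedy_queries ?\<rho> xs S)" T]
        card_greedy_queries(2)[of ?\<rho> xs] T by simp
    \<comment> \<open>A repeated ERM query contributes its greedy queries only once.\<close>
    also have "\<dots> \<le> length ?Q * T" by (intro mult_right_mono card_length) simp
    finally show ?thesis by (simp add: num_erm_queries_def mult.commute)
  qed
  then have "real (num_weak_queries ?W) \<le> real T * real (num_erm_queries ?E)"
    using of_nat_mono[where 'a = real] by fastforce
  moreover have "real T * real (num_erm_queries ?E) \<le> real T * g T"
    using query_bound C T valid by (intro mult_left_mono) auto
  ultimately show "real (mistakes ?W) \<le> f T \<and> real (num_weak_queries ?W) \<le> real T * g T"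
    by linarith
qed

end
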